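(* The Schwarzschild spacetime has the following curvature properties: (i) it is Ricci flat, and hence $R=cir(R)=C=har(R)=P$; (ii) it fulfills $R\cdot R=\frac{m}{r^3}\,Q(g,R)$, and hence it is a Deszcz pseudosymmetric manifold; (iii) it satisfies $\mathrm{div}R=0$, and hence the curvature of the spacetime is harmonic; (iv) the compatible tensor for $R$ has the following general form in the coordinates $(t,r,\theta,\phi)$: $$\begin{pmatrix}\mathcal H_{11}&\mathcal H_{12}&0&0\\ \mathcal H_{12}&\mathcal H_{22}&0&0\\ 0&0&\mathcal H_{33}&\mathcal H_{34}\\ 0&0&\mathcal H_{34}&\mathcal H_{44}\end{pmatrix},$$ where $\mathcal H_{ij}$ are arbitrary scalars.
   Context: The Schwarzschild spacetime is the $4$-dimensional Lorentzian manifold with coordinates $(x^1,x^2,x^3,x^4)=(t,r,\theta,\phi)$ and metric $ds^2=\left(1-\frac{2m}{r}\right)dt^2-2\,dt\,dr-r^2(d\theta^2+\sin^2\theta\, d\phi^2)$, with $m$ constant. Curvature conventions: $R_{efst}=g_{e\alpha}(\partial_t\Gamma^\alpha_{fs}-\partial_s\Gamma^\alpha_{ft}+\Gamma^\beta_{fs}\Gamma^\alpha_{\beta t}-\Gamma^\beta_{ft}\Gamma^\alpha_{\beta s})$, $S_{fs}=g^{et}R_{efst}$, $\bar\kappa=g^{fs}S_{fs}$. With $(X\wedge Z)_{efst}=X_{et}Z_{fs}+X_{fs}Z_{et}-X_{es}Z_{ft}-X_{ft}Z_{es}$: $har(R)=R-\frac12 g\wedge S$; $cir(R)=R-\frac{\bar\kappa}{24}g\wedge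 g$; $C=R-\frac12 g\wedge S+\frac{\bar\kappa}{12}g\wedge g$; $P_{efst}=R_{efst}-\frac13(g_{et}S_{fs}-g_{ft}S_{es})$. $\mathrm{div}R$ is the divergence $\nabla^eR_{efst}$. For a $(0,m)$ tensor $W$: $(R\cdot W)_{b_1\cdots b_m rs}=-[R^\alpha{}_{b_1 rs}W_{\alpha b_2\cdots b_m}+\cdots+R^\alpha{}_{b_m rs}W_{b_1\cdots b_{m-1}\alpha}]$ and $Q(g,W)_{b_1\cdots b_m rs}=g_{sb_1}W_{rb_2\cdots b_m}+\cdots+g_{sb_m}W_{b_1\cdots b_{m-1}r}-g_{rb_1}W_{sb_2\cdots b_m}-\cdots-g_{rb_m}W_{b_1\cdots b_{m-1}s}$. Deszcz pseudosymmetric means $R\cdot R=\mathscr F\,Q(g,R)$ for a smooth function $\mathscr F$ on the set where $Q(g,R)\ne0$. A $(0,2)$ tensor $H$ is compatible for $R$ if the cyclic sum over $e,f,s$ of $H_e{}^d R_{fstd}$ vanishes, with $H_e{}^d=g^{d\alpha}H_{e\alpha}$.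
   Formalization: In (iv), that every compatible tensor has the displayed form is stated only for m ≠ 0: for m = 0 the metric is flat, R = 0, and every tensor is compatible, so the claim fails. The converse holds for all m. *)

theory Defs
  imports "HOL-Analysis.Analysis"
begin

section \<open>Tensor calculus in a coordinate chart\<close>

text \<open>
  A metric on a coordinate domain is a matrix-valued function of the coordinates. Tensor fields
  of a fixed small rank are functions of the point and of their indices; where the rank is
  arbitrary, the indices form a list \<open>bs\<close>, and \<open>bs[i := a]\<close> puts the index \<open>a\<close> at position \<open>i\<close>.
\<close>

type_synonym 'n metric = "real ^ 'n \<Rightarrow> real ^ 'n ^ 'n"

definition partial :: "'n::finite \<Rightarrow> (real ^ 'n \<Rightarrow> real) \<Rightarrow> real ^ 'n \<Rightarrow> real" where
  "partial k f x = deriv (\<lambda>h. f (x + h *\<^sub>R axis k 1)) 0"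

text \<open>For open \<open>S\<close>, \<open>C_on k S f\<close> says that \<open>f\<close> is of class \<open>C\<^sup>k\<close> on \<open>S\<close>.\<close>

primrec C_on :: "nat \<Rightarrow> (real ^ 'n::finite) set \<Rightarrow> (real ^ 'n \<Rightarrow> real) \<Rightarrow> bool" where
  "C_on 0 S f \<longleftrightarrow> continuous_on S f"
| "C_on (Suc k) S f \<longleftrightarrow> (\<forall>x\<in>S. f differentiable (at x)) \<and> (\<forall>i. C_on k S (partial i f))"

definition smooth_on :: "(real ^ 'n::finite) set \<Rightarrow> (real ^ 'n \<Rightarrow> real) \<Rightarrow> bool" where
  "smooth_on S f \<longleftrightarrow> (\<forall>k. C_on k S f)"

definition inv_metric :: "'n::finite metric \<Rightarrow> real ^ 'n \<Rightarrow> 'n \<Rightarrow> 'n \<Rightarrow> real" where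
  "inv_metric g x a b = matrix_inv (g x) $ a $ b"

text \<open>\<open>christoffel g x a b c\<close> is \<open>\<Gamma>\<^sup>a\<^sub>b\<^sub>c\<close>.\<close>

definition christoffel :: "'n::finite metric \<Rightarrow> real ^ 'n \<Rightarrow> 'n \<Rightarrow> 'n \<Rightarrow> 'n \<Rightarrow> real" where
  "christoffel g x a b c = (1/2) * (\<Sum>d\<in>UNIV. inv_metric g x a d *
     (partial b (\<lambda>y. g y $ d $ c) x + partial c (\<lambda>y. g y $ b $ d) x
      - partial d (\<lambda>y. g y $ b $ c) x))"

definition riemann :: "'n::finite metric \<Rightarrow> real ^ 'n \<Rightarrow> 'n \<Rightarrow> 'n \<Rightarrow> 'n \<Rightarrow> 'n \<Rightarrow> real" where
  "riemann g x e f s t = (\<Sum>a\<in>UNIV. g x $ e $ a *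
     (partial t (\<lambda>y. christoffel g y a f s) x - partial s (\<lambda>y. christoffel g y a f t) x
      + (\<Sum>b\<in>UNIV. christoffel g x b f s * christoffel g x a b t)
      - (\<Sum>b\<in>UNIV. christoffel g x b f t * christoffel g x a b s)))"

text \<open>\<open>riemann_up g x a f s t\<close> is \<open>R\<^sup>a\<^sub>f\<^sub>s\<^sub>t\<close>.\<close>

definition riemann_up :: "'n::finite metric \<Rightarrow> real ^ 'n \<Rightarrow> 'n \<Rightarrow> 'n \<Rightarrow> 'n \<Rightarrow> 'n \<Rightarrow> real" where
  "riemann_up g x a f s t = (\<Sum>e\<in>UNIV. inv_metric g x a e * riemann g x e f s t)"

definition ricci :: "'n::finite metric \<Rightarrow> real ^ 'n \<Rightarrow> 'n \<Rightarrow> 'n \<Rightarrow> real" where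
  "ricci g x f s = (\<Sum>e\<in>UNIV. \<Sum>t\<in>UNIV. inv_metric g x e t * riemann g x e f s t)"

definition scalar_curv :: "'n::finite metric \<Rightarrow> real ^ 'n \<Rightarrow> real" where
  "scalar_curv g x = (\<Sum>f\<in>UNIV. \<Sum>s\<in>UNIV. inv_metric g x f s * ricci g x f s)"

definition ricci_flat_on :: "(real ^ 'n::finite) set \<Rightarrow> 'n metric \<Rightarrow> bool" where
  "ricci_flat_on U g \<longleftrightarrow> (\<forall>x\<in>U. \<forall>f s. ricci g x f s = 0)"

definition kulkarni_nomizu ::
  "('n \<Rightarrow> 'n \<Rightarrow> real) \<Rightarrow> ('n \<Rightarrow> 'n \<Rightarrow> real) \<Rightarrow> 'n \<Rightarrow> 'n \<Rightarrow> 'n \<Rightarrow> 'n \<Rightarrow> real" where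
  "kulkarni_nomizu X Z e f s t = X e t * Z f s + X f s * Z e t - X e s * Z f t - X f t * Z e s"

text \<open>The numerical coefficients in the next four tensors are those of dimension 4.\<close>

definition conharmonic :: "4 metric \<Rightarrow> real ^ 4 \<Rightarrow> 4 \<Rightarrow> 4 \<Rightarrow> 4 \<Rightarrow> 4 \<Rightarrow> real" where
  "conharmonic g x e f s t = riemann g x e f s t
     - (1/2) * kulkarni_nomizu (\<lambda>i j. g x $ i $ j) (ricci g x) e f s t"

definition concircular :: "4 metric \<Rightarrow> real ^ 4 \<Rightarrow> 4 \<Rightarrow> 4 \<Rightarrow> 4 \<Rightarrow> 4 \<Rightarrow> real" where
  "concircular g x e f s t = riemann g x e f s t
     - (scalar_curv g x / 24) *
         kulkarni_nomizu (\<lambda>i j. g x $ i $ j) (\<lambda>i j. g x $ i $ j) e f s t"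

definition conformal_weyl :: "4 metric \<Rightarrow> real ^ 4 \<Rightarrow> 4 \<Rightarrow> 4 \<Rightarrow> 4 \<Rightarrow> 4 \<Rightarrow> real" where
  "conformal_weyl g x e f s t = riemann g x e f s t
     - (1/2) * kulkarni_nomizu (\<lambda>i j. g x $ i $ j) (ricci g x) e f s t
     + (scalar_curv g x / 12) *
         kulkarni_nomizu (\<lambda>i j. g x $ i $ j) (\<lambda>i j. g x $ i $ j) e f s t"

definition projective :: "4 metric \<Rightarrow> real ^ 4 \<Rightarrow> 4 \<Rightarrow> 4 \<Rightarrow> 4 \<Rightarrow> 4 \<Rightarrow> real" where
  "projective g x e f s t = riemann g x e f s t
     - (1/3) * (g x $ e $ t * ricci g x f s - g x $ f $ t * ricci g x e s)"

definition riemann_list :: "'n::finite metric \<Rightarrow> real ^ 'n \<Rightarrow> 'n list \<Rightarrow> real" where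
  "riemann_list g x bs = riemann g x (bs ! 0) (bs ! 1) (bs ! 2) (bs ! 3)"

text \<open>\<open>curv_dot g W x bs r s\<close> is \<open>(R \<cdot> W)\<close> with index list \<open>bs\<close> followed by \<open>r, s\<close>;
  the index order of \<open>tachibana\<close>, which is \<open>Q(g, W)\<close>, is the same.\<close>

definition curv_dot :: "'n::finite metric \<Rightarrow> (real ^ 'n \<Rightarrow> 'n list \<Rightarrow> real) \<Rightarrow>
    real ^ 'n \<Rightarrow> 'n list \<Rightarrow> 'n \<Rightarrow> 'n \<Rightarrow> real" where
  "curv_dot g W x bs r s =
     - (\<Sum>i<length bs. \<Sum>a\<in>UNIV. riemann_up g x a (bs ! i) r s * W x (bs[i := a]))"

definition tachibana :: "'n::finite metric \<Rightarrow> (real ^ 'n \<Rightarrow> 'n list \<Rightarrow> real) \<Rightarrow>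
    real ^ 'n \<Rightarrow> 'n list \<Rightarrow> 'n \<Rightarrow> 'n \<Rightarrow> real" where
  "tachibana g W x bs r s =
     (\<Sum>i<length bs. g x $ s $ (bs ! i) * W x (bs[i := r]))
     - (\<Sum>i<length bs. g x $ r $ (bs ! i) * W x (bs[i := s]))"

definition deszcz_pseudosymmetric_on :: "(real ^ 'n::finite) set \<Rightarrow> 'n metric \<Rightarrow> bool" where
  "deszcz_pseudosymmetric_on U g \<longleftrightarrow>
     (let V = {x \<in> U. \<exists>bs r s. length bs = 4 \<and> tachibana g (riemann_list g) x bs r s \<noteq> 0}
      in \<exists>F. smooth_on V F \<and> (\<forall>x\<in>V. \<forall>bs r s. length bs = 4 \<longrightarrow>
           curv_dot g (riemann_list g) x bs r s = F x * tachibana g (riemann_list g) x bs r s))"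

text \<open>\<open>cov_deriv g W x k bs\<close> is \<open>\<nabla>\<^sub>k W\<close> with index list \<open>bs\<close>, for the Levi-Civita connection.\<close>

definition cov_deriv :: "'n::finite metric \<Rightarrow> (real ^ 'n \<Rightarrow> 'n list \<Rightarrow> real) \<Rightarrow>
    real ^ 'n \<Rightarrow> 'n \<Rightarrow> 'n list \<Rightarrow> real" where
  "cov_deriv g W x k bs = partial k (\<lambda>y. W y bs) x
     - (\<Sum>i<length bs. \<Sum>a\<in>UNIV. christoffel g x a k (bs ! i) * W x (bs[i := a]))"

definition div_riemann :: "'n::finite metric \<Rightarrow> real ^ 'n \<Rightarrow> 'n \<Rightarrow> 'n \<Rightarrow> 'n \<Rightarrow> real" where
  "div_riemann g x f s t =
     (\<Sum>e\<in>UNIV. \<Sum>k\<in>UNIV. inv_metric g x e k * cov_deriv g (riemann_list g) x k [e, f, s, t])"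

definition harmonic_curvature_on :: "(real ^ 'n::finite) set \<Rightarrow> 'n metric \<Rightarrow> bool" where
  "harmonic_curvature_on U g \<longleftrightarrow> (\<forall>x\<in>U. \<forall>f s t. div_riemann g x f s t = 0)"

text \<open>\<open>raise2 g H x e d\<close> is \<open>H\<^sub>e\<^sup>d\<close>. No symmetry of \<open>H\<close> is assumed.\<close>

definition raise2 :: "'n::finite metric \<Rightarrow> (real ^ 'n \<Rightarrow> real ^ 'n ^ 'n) \<Rightarrow>
    real ^ 'n \<Rightarrow> 'n \<Rightarrow> 'n \<Rightarrow> real" where
  "raise2 g H x e d = (\<Sum>a\<in>UNIV. inv_metric g x d a * H x $ e $ a)"

definition compatible_on ::
  "(real ^ 'n::finite) set \<Rightarrow> 'n metric \<Rightarrow> (real ^ 'n \<Rightarrow> real ^ 'n ^ 'n) \<Rightarrow> bool" where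
  "compatible_on U g H \<longleftrightarrow> (\<forall>x\<in>U. \<forall>e f s t.
     (\<Sum>d\<in>UNIV. raise2 g H x e d * riemann g x f s t d)
     + (\<Sum>d\<in>UNIV. raise2 g H x f d * riemann g x s e t d)
     + (\<Sum>d\<in>UNIV. raise2 g H x s d * riemann g x e f t d) = 0)"


section \<open>The Schwarzschild spacetime\<close>

text \<open>
  The coordinates are \<open>(x $ 1, x $ 2, x $ 3, x $ 4) = (t, r, \<theta>, \<phi>)\<close>. The form
  \<open>- 2 dt dr\<close> gives the two off-diagonal entries \<open>- 1\<close>. The angle \<open>\<phi>\<close> is left unrestricted,
  since nothing depends on it; the metric is regular at \<open>r = 2 m\<close> in these coordinates.
\<close>

definition schw_domain :: "(real ^ 4) set" where
  "schw_domain = {x. 0 < x $ 2 \<and> 0 < x $ 3 \<and> x $ 3 < pi}"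

definition schw_metric :: "real \<Rightarrow> 4 metric" where
  "schw_metric m x = vector
     [vector [1 - 2 * m / x $ 2, - 1, 0, 0],
      vector [- 1, 0, 0, 0],
      vector [0, 0, - (x $ 2)\<^sup>2, 0],
      vector [0, 0, 0, - ((x $ 2)\<^sup>2 * (sin (x $ 3))\<^sup>2)]]"

end

theory Submission
  imports Defs
begin

text \<open>
  Split the metric as \<open>g = h + k\<close>, with \<open>h\<close> the block of \<open>(t, r)\<close> and \<open>k\<close> the block of
  \<open>(\<theta>, \<phi>)\<close>. The curvature is \<open>R = m/r\<^sup>3 (h \<and> k - h \<and> h - k \<and> k)\<close>, and everything follows
  from this formula. The operators of \<open>h \<and> h\<close> and \<open>k \<and> k\<close> rotate one block and annihilate both
  \<open>h\<close> and \<open>k\<close>, so only the mixed part of \<open>R\<close> acts on \<open>R\<close>, with coefficient \<open>m/r\<^sup>3\<close> relative to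
  the mixed part of \<open>1/2 g \<and> g\<close>: this is the pseudosymmetry. As \<open>\<nabla>g = 0\<close>, we have \<open>\<nabla>k = - \<nabla>h\<close>, so that
  \<open>\<nabla>R\<close> is determined by \<open>\<nabla>h\<close>. The cyclic sum for a tensor \<open>H\<close> is a combination of entries of \<open>h\<close>
  and \<open>k\<close> with two antisymmetric tensors as coefficients, and \<open>H\<close> is compatible iff both vanish.
\<close>

section \<open>Vector entries, indices and partial derivatives\<close>

lemma vector_4 [simp]:
  "(vector [w, x, y, z] :: ('a::zero) ^ 4) $ 1 = w"
  "(vector [w, x, y, z] :: ('a::zero) ^ 4) $ 2 = x"
  "(vector [w, x, y, z] :: ('a::zero) ^ 4) $ 3 = y"
  "(vector [w, x, y, z] :: ('a::zero) ^ 4) $ 4 = z"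
  by (simp_all add: vector_def)

text \<open>Used as an induction rule, it splits a tensor identity into components with numeral
  indices, on which the \<open>simp\<close> rules for explicit matrices fire.\<close>

lemma index_4_induct: "P 1 \<Longrightarrow> P 2 \<Longrightarrow> P 3 \<Longrightarrow> P 4 \<Longrightarrow> P (i :: 4)"
  using exhaust_4[of i] by auto

lemma partialI:
  "((\<lambda>h. f (x + h *\<^sub>R axis k 1)) has_real_derivative D) (at 0) \<Longrightarrow> partial k f x = D"
  unfolding partial_def by (rule DERIV_imp_deriv)

text \<open>A short segment through a point of an open set stays in the set. So a closed formula
  valid only on the coordinate domain may be differentiated there.\<close>

lemma partial_cong_open:
  assumes "open S" "x \<in> S" "\<And>y. y \<in> S \<Longrightarrow> f y = f' y"
  shows "partial k f x = partial k f' x"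
  unfolding partial_def
proof (rule deriv_cong_ev)
  have "((\<lambda>h. x + h *\<^sub>R axis k 1) \<longlongrightarrow> x + 0 *\<^sub>R axis k 1) (nhds (0::real))"
    by (intro tendsto_intros filterlim_ident)
  then have "\<forall>\<^sub>F h::real in nhds 0. x + h *\<^sub>R axis k 1 \<in> S"
    using assms(1,2) by (auto dest: topological_tendstoD)
  then show "\<forall>\<^sub>F h in nhds 0. f (x + h *\<^sub>R axis k 1) = f' (x + h *\<^sub>R axis k 1)"
    by eventually_elim (rule assms(3))
qed simp

section \<open>Coordinate domain, metric blocks and inverse metric\<close>

lemma open_schw_domain: "open schw_domain"
  unfolding schw_domain_def
  by (intro open_Collect_conj open_Collect_less continuous_intros)

lemma schw_domainD:
  assumes "x \<in> schw_domain"
  shows "x $ 2 > 0" "sin (x $ 3) > 0"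
  using assms by (auto simp: schw_domain_def intro: sin_gt_zero)

text \<open>\<open>schw_orbit\<close> and \<open>schw_sphere\<close> are the blocks \<open>h\<close> and \<open>k\<close> of the metric.\<close>

definition schw_orbit :: "real \<Rightarrow> real ^ 4 \<Rightarrow> 4 \<Rightarrow> 4 \<Rightarrow> real" where
  "schw_orbit m x i j = (vector
     [vector [1 - 2 * m / x $ 2, - 1, 0, 0], vector [- 1, 0, 0, 0], 0, 0] :: real ^ 4 ^ 4) $ i $ j"

definition schw_sphere :: "real ^ 4 \<Rightarrow> 4 \<Rightarrow> 4 \<Rightarrow> real" where
  "schw_sphere x i j = (vector
     [0, 0, vector [0, 0, - (x $ 2)\<^sup>2, 0],
      vector [0, 0, 0, - ((x $ 2)\<^sup>2 * (sin (x $ 3))\<^sup>2)]] :: real ^ 4 ^ 4) $ i $ j"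

definition schw_inverse :: "real \<Rightarrow> real ^ 4 \<Rightarrow> real ^ 4 ^ 4" where
  "schw_inverse m x = vector
     [vector [0, - 1, 0, 0],
      vector [- 1, - (1 - 2 * m / x $ 2), 0, 0],
      vector [0, 0, - 1 / (x $ 2)\<^sup>2, 0],
      vector [0, 0, 0, - 1 / ((x $ 2)\<^sup>2 * (sin (x $ 3))\<^sup>2)]]"

lemma schw_orbit_simps [simp]:
  "schw_orbit m x 1 1 = 1 - 2 * m / x $ 2"
  "schw_orbit m x 1 2 = - 1" "schw_orbit m x 2 1 = - 1" "schw_orbit m x 2 2 = 0"
  "schw_orbit m x i 3 = 0" "schw_orbit m x i 4 = 0" "schw_orbit m x 3 i = 0" "schw_orbit m x 4 i = 0"
  using exhaust_4[of i] by (auto simp: schw_orbit_def)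

lemma schw_sphere_simps [simp]:
  "schw_sphere x 3 3 = - (x $ 2)\<^sup>2" "schw_sphere x 4 4 = - ((x $ 2)\<^sup>2 * (sin (x $ 3))\<^sup>2)"
  "schw_sphere x 3 4 = 0" "schw_sphere x 4 3 = 0"
  "schw_sphere x i 1 = 0" "schw_sphere x i 2 = 0" "schw_sphere x 1 i = 0" "schw_sphere x 2 i = 0"
  using exhaust_4[of i] by (auto simp: schw_sphere_def)

lemma schw_orbit_commute: "schw_orbit m x i j = schw_orbit m x j i"
  using exhaust_4[of i] exhaust_4[of j] by auto

lemma schw_sphere_commute: "schw_sphere x i j = schw_sphere x j i"
  using exhaust_4[of i] exhaust_4[of j] by auto

lemma schw_metric_split: "schw_metric m x $ i $ j = schw_orbit m x i j + schw_sphere x i j"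
  using exhaust_4[of i] exhaust_4[of j] by (auto simp: schw_metric_def)

text \<open>A one-sided inverse of a square matrix is two-sided. This gives the existence needed to
  unfold the choice in \<open>matrix_inv\<close>; uniqueness then identifies the chosen
  matrix.\<close>

lemma matrix_inv_eqI:
  fixes A B :: "real ^ 'n ^ 'n"
  assumes "A ** B = mat 1"
  shows "matrix_inv A = B"
proof -
  have "\<exists>A'. A ** A' = mat 1 \<and> A' ** A = mat 1"
    using assms matrix_left_right_inverse by blast
  then have "matrix_inv A ** A = mat 1"
    unfolding matrix_inv_def by (metis (mono_tags, lifting) someI_ex)
  then show ?thesis
    by (metis assms matrix_mul_assoc matrix_mul_lid matrix_mul_rid)
qed

lemma inv_metric_schw:
  assumes "x \<in> schw_domain"
  shows "inv_metric (schw_metric m) x a b = schw_inverse m x $ a $ b"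
proof -
  have "schw_metric m x ** schw_inverse m x = mat 1"
    using schw_domainD[OF assms]
    by (simp add: vec_eq_iff forall_4 matrix_matrix_mult_def sum_4 mat_def schw_metric_def
        schw_inverse_def)
  then show ?thesis
    unfolding inv_metric_def by (simp add: matrix_inv_eqI)
qed

lemma schw_inverse_simps [simp]:
  "schw_inverse m x $ 1 = vector [0, - 1, 0, 0]"
  "schw_inverse m x $ 2 = vector [- 1, - (1 - 2 * m / x $ 2), 0, 0]"
  "schw_inverse m x $ 3 = vector [0, 0, - 1 / (x $ 2)\<^sup>2, 0]"
  "schw_inverse m x $ 4 = vector [0, 0, 0, - 1 / ((x $ 2)\<^sup>2 * (sin (x $ 3))\<^sup>2)]"
  by (simp_all add: schw_inverse_def)

section \<open>Smoothness of inverse powers of a coordinate\<close>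

lemma C_on_subset: "C_on k T f \<Longrightarrow> S \<subseteq> T \<Longrightarrow> C_on k S f"
  by (induct k arbitrary: f) (auto intro: continuous_on_subset)

lemma C_on_cong:
  assumes "open S" "\<And>x. x \<in> S \<Longrightarrow> f x = f' x" "C_on k S f"
  shows "C_on k S f'"
  using assms(2,3)
proof (induct k arbitrary: f f')
  case 0
  then show ?case using continuous_on_cong[of S S f f'] by simp
next
  case (Suc k)
  have "f' differentiable (at x)" if x: "x \<in> S" for x
  proof -
    obtain D where "(f has_derivative D) (at x)"
      using Suc.prems(2) x by (auto simp: differentiable_def)
    then have "(f' has_derivative D) (at x)"
      using assms(1) x Suc.prems(1) by (rule has_derivative_transform_within_open)
    then show ?thesis by (rule differentiableI)
  qed
  moreover have "C_on k S (partial i f')" for i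
  proof (rule Suc.hyps)
    show "partial i f x = partial i f' x" if "x \<in> S" for x
      using assms(1) that Suc.prems(1) by (rule partial_cong_open)
    show "C_on k S (partial i f)"
      using Suc.prems(2) by simp
  qed
  ultimately show ?case by simp
qed

text \<open>The functions \<open>c / (x $ i) ^ n\<close> are closed under partial derivatives, so
  the induction on \<open>k\<close> goes through with \<open>c\<close> and \<open>n\<close>
  arbitrary.\<close>

lemma C_on_inverse_power:
  fixes i :: "'n::finite"
  shows "C_on k {x :: real ^ 'n. x $ i > 0} (\<lambda>x. c / (x $ i) ^ n)"
proof (induct k arbitrary: c n)
  case 0
  show ?case by (auto intro!: continuous_intros)
next
  case (Suc k)
  have "(\<lambda>x. c / (x $ i) ^ n) differentiable (at x)" if "x $ i > 0" for x :: "real ^ 'n"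
    using that
    by (intro differentiable_divide differentiable_power differentiable_const
          bounded_linear_imp_differentiable bounded_linear_vec_nth) auto
  moreover have "C_on k {x. x $ i > 0} (partial j (\<lambda>x. c / (x $ i) ^ n))" for j
  \<comment> \<open>For \<open>j \<noteq> i\<close> the derivative is zero, which belongs to the
    same family with numerator \<open>0\<close>.\<close>
  proof (rule C_on_cong[OF _ _ Suc.hyps[of "if j = i then - c * real n else 0" "Suc n"]])
    show "open {x :: real ^ 'n. x $ i > 0}"
      by (intro open_Collect_less continuous_intros)
    show "(if j = i then - c * real n else 0) / (x $ i) ^ Suc n = partial j (\<lambda>x. c / (x $ i) ^ n) x"
      if "x \<in> {x. x $ i > 0}" for x :: "real ^ 'n"
      using that
      by (intro partialI[symmetric], cases n)
        (auto simp: axis_def field_simps  intro!: derivative_eq_intros,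
          rule ccontr, simp flip: power_Suc)
  qed
  ultimately show ?case by simp
qed

section \<open>First derivatives of the metric and Christoffel symbols\<close>

definition schw_deriv_orbit :: "real \<Rightarrow> real ^ 4 \<Rightarrow> 4 \<Rightarrow> 4 \<Rightarrow> 4 \<Rightarrow> real" where
  "schw_deriv_orbit m x k i j = (if k = 2 \<and> i = 1 \<and> j = 1 then 2 * m / (x $ 2)\<^sup>2 else 0)"

text \<open>Each entry of the sphere block is \<open>(x $ 2)\<^sup>2\<close> times a function of the
  angles, so its radial derivative is multiplication by \<open>2 / x $ 2\<close>. The first index
  \<open>k\<close> is the direction of differentiation.\<close>

definition schw_deriv_sphere :: "real ^ 4 \<Rightarrow> 4 \<Rightarrow> 4 \<Rightarrow> 4 \<Rightarrow> real" where
  "schw_deriv_sphere x k i j =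
     (if k = 2 then 2 / x $ 2 * schw_sphere x i j
      else if k = 3 \<and> i = 4 \<and> j = 4
      then - 2 * (x $ 2)\<^sup>2 * sin (x $ 3) * cos (x $ 3) else 0)"

lemma has_deriv_schw_orbit:
  assumes "x \<in> schw_domain"
  shows "((\<lambda>h. schw_orbit m (x + h *\<^sub>R axis k 1) i j) has_real_derivative
           schw_deriv_orbit m x k i j) (at 0)"
  using schw_domainD[OF assms]
  by (induct i rule: index_4_induct; induct j rule: index_4_induct; induct k rule: index_4_induct;
      simp add: axis_def schw_deriv_orbit_def)
    (auto simp: power2_eq_square intro!: derivative_eq_intros)

lemma has_deriv_schw_sphere:
  assumes "x \<in> schw_domain"
  shows "((\<lambda>h. schw_sphere (x + h *\<^sub>R axis k 1) i j) has_real_derivative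
           schw_deriv_sphere x k i j) (at 0)"
  using schw_domainD[OF assms]
  by (induct i rule: index_4_induct; induct j rule: index_4_induct; induct k rule: index_4_induct;
      simp add: axis_def schw_deriv_sphere_def)
    (auto simp: power2_eq_square field_simps intro!: derivative_eq_intros)

lemma partial_schw_metric:
  assumes "x \<in> schw_domain"
  shows "partial k (\<lambda>y. schw_metric m y $ i $ j) x
           = schw_deriv_orbit m x k i j + schw_deriv_sphere x k i j"
  unfolding schw_metric_split
  by (intro partialI DERIV_add has_deriv_schw_orbit has_deriv_schw_sphere assms)

text \<open>The upper index comes first. The last lower index is left as a vector, so that one
  \<open>simp\<close> rule covers four components.\<close>

definition schw_christoffel :: "real \<Rightarrow> real ^ 4 \<Rightarrow> 4 \<Rightarrow> 4 \<Rightarrow> real ^ 4" where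
  "schw_christoffel m x a b = (vector
     [vector [vector [m / (x $ 2)\<^sup>2, 0, 0, 0],
              0,
              vector [0, 0, - x $ 2, 0],
              vector [0, 0, 0, - x $ 2 * (sin (x $ 3))\<^sup>2]],
      vector [vector [(1 - 2 * m / x $ 2) * m / (x $ 2)\<^sup>2, - m / (x $ 2)\<^sup>2, 0, 0],
              vector [- m / (x $ 2)\<^sup>2, 0, 0, 0],
              vector [0, 0, 2 * m - x $ 2, 0],
              vector [0, 0, 0, (2 * m - x $ 2) * (sin (x $ 3))\<^sup>2]],
      vector [0,
              vector [0, 0, 1 / x $ 2, 0],
              vector [0, 1 / x $ 2, 0, 0],
              vector [0, 0, 0, - sin (x $ 3) * cos (x $ 3)]],
      vector [0,
              vector [0, 0, 0, 1 / x $ 2],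
              vector [0, 0, 0, cos (x $ 3) / sin (x $ 3)],
              vector [0, 1 / x $ 2, cos (x $ 3) / sin (x $ 3), 0]]] :: real ^ 4 ^ 4 ^ 4) $ a $ b"

lemma schw_christoffel_simps [simp]:
  "schw_christoffel m x 1 1 = vector [m / (x $ 2)\<^sup>2, 0, 0, 0]"
  "schw_christoffel m x 1 2 = 0"
  "schw_christoffel m x 1 3 = vector [0, 0, - x $ 2, 0]"
  "schw_christoffel m x 1 4 = vector [0, 0, 0, - x $ 2 * (sin (x $ 3))\<^sup>2]"
  "schw_christoffel m x 2 1
     = vector [(1 - 2 * m / x $ 2) * m / (x $ 2)\<^sup>2, - m / (x $ 2)\<^sup>2, 0, 0]"
  "schw_christoffel m x 2 2 = vector [- m / (x $ 2)\<^sup>2, 0, 0, 0]"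
  "schw_christoffel m x 2 3 = vector [0, 0, 2 * m - x $ 2, 0]"
  "schw_christoffel m x 2 4 = vector [0, 0, 0, (2 * m - x $ 2) * (sin (x $ 3))\<^sup>2]"
  "schw_christoffel m x 3 1 = 0"
  "schw_christoffel m x 3 2 = vector [0, 0, 1 / x $ 2, 0]"
  "schw_christoffel m x 3 3 = vector [0, 1 / x $ 2, 0, 0]"
  "schw_christoffel m x 3 4 = vector [0, 0, 0, - sin (x $ 3) * cos (x $ 3)]"
  "schw_christoffel m x 4 1 = 0"
  "schw_christoffel m x 4 2 = vector [0, 0, 0, 1 / x $ 2]"
  "schw_christoffel m x 4 3 = vector [0, 0, 0, cos (x $ 3) / sin (x $ 3)]"
  "schw_christoffel m x 4 4 = vector [0, 1 / x $ 2, cos (x $ 3) / sin (x $ 3), 0]"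
  by (simp_all add: schw_christoffel_def)

lemma christoffel_schw:
  assumes "x \<in> schw_domain"
  shows "christoffel (schw_metric m) x a b c = schw_christoffel m x a b $ c"
  using schw_domainD[OF assms]
  unfolding christoffel_def sum_4 inv_metric_schw[OF assms] partial_schw_metric[OF assms]
  by (induct a rule: index_4_induct; induct b rule: index_4_induct; induct c rule: index_4_induct;
      simp add: schw_deriv_orbit_def schw_deriv_sphere_def power2_eq_square)
    (simp_all add: field_simps)

definition schw_deriv_christoffel :: "real \<Rightarrow> real ^ 4 \<Rightarrow> 4 \<Rightarrow> 4 \<Rightarrow> 4 \<Rightarrow> real ^ 4" where
  "schw_deriv_christoffel m x k a b = (vector
     [0,
      vector
       [vector [vector [- 2 * m / (x $ 2) ^ 3, 0, 0, 0],
                0,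
                vector [0, 0, - 1, 0],
                vector [0, 0, 0, - (sin (x $ 3))\<^sup>2]],
        vector [vector [6 * m\<^sup>2 / (x $ 2) ^ 4 - 2 * m / (x $ 2) ^ 3, 2 * m / (x $ 2) ^ 3, 0, 0],
                vector [2 * m / (x $ 2) ^ 3, 0, 0, 0],
                vector [0, 0, - 1, 0],
                vector [0, 0, 0, - (sin (x $ 3))\<^sup>2]],
        vector [0,
                vector [0, 0, - 1 / (x $ 2)\<^sup>2, 0],
                vector [0, - 1 / (x $ 2)\<^sup>2, 0, 0],
                0],
        vector [0,
                vector [0, 0, 0, - 1 / (x $ 2)\<^sup>2],
                0,
                vector [0, - 1 / (x $ 2)\<^sup>2, 0, 0]]],
      vector
       [vector [0, 0, 0, vector [0, 0, 0, - 2 * x $ 2 * sin (x $ 3) * cos (x $ 3)]],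
        vector [0, 0, 0, vector [0, 0, 0, 2 * (2 * m - x $ 2) * sin (x $ 3) * cos (x $ 3)]],
        vector [0, 0, 0, vector [0, 0, 0, (sin (x $ 3))\<^sup>2 - (cos (x $ 3))\<^sup>2]],
        vector [0,
                0,
                vector [0, 0, 0, - 1 / (sin (x $ 3))\<^sup>2],
                vector [0, 0, - 1 / (sin (x $ 3))\<^sup>2, 0]]],
      0] :: real ^ 4 ^ 4 ^ 4 ^ 4) $ k $ a $ b"

lemma schw_deriv_christoffel_simps [simp]:
  "schw_deriv_christoffel m x 1 a b = 0"
  "schw_deriv_christoffel m x 2 1 1 = vector [- 2 * m / (x $ 2) ^ 3, 0, 0, 0]"
  "schw_deriv_christoffel m x 2 1 2 = 0"
  "schw_deriv_christoffel m x 2 1 3 = vector [0, 0, - 1, 0]"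
  "schw_deriv_christoffel m x 2 1 4 = vector [0, 0, 0, - (sin (x $ 3))\<^sup>2]"
  "schw_deriv_christoffel m x 2 2 1
     = vector [6 * m\<^sup>2 / (x $ 2) ^ 4 - 2 * m / (x $ 2) ^ 3, 2 * m / (x $ 2) ^ 3, 0, 0]"
  "schw_deriv_christoffel m x 2 2 2 = vector [2 * m / (x $ 2) ^ 3, 0, 0, 0]"
  "schw_deriv_christoffel m x 2 2 3 = vector [0, 0, - 1, 0]"
  "schw_deriv_christoffel m x 2 2 4 = vector [0, 0, 0, - (sin (x $ 3))\<^sup>2]"
  "schw_deriv_christoffel m x 2 3 1 = 0"
  "schw_deriv_christoffel m x 2 3 2 = vector [0, 0, - 1 / (x $ 2)\<^sup>2, 0]"
  "schw_deriv_christoffel m x 2 3 3 = vector [0, - 1 / (x $ 2)\<^sup>2, 0, 0]"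
  "schw_deriv_christoffel m x 2 3 4 = 0"
  "schw_deriv_christoffel m x 2 4 1 = 0"
  "schw_deriv_christoffel m x 2 4 2 = vector [0, 0, 0, - 1 / (x $ 2)\<^sup>2]"
  "schw_deriv_christoffel m x 2 4 3 = 0"
  "schw_deriv_christoffel m x 2 4 4 = vector [0, - 1 / (x $ 2)\<^sup>2, 0, 0]"
  "schw_deriv_christoffel m x 3 a 1 = 0"
  "schw_deriv_christoffel m x 3 a 2 = 0"
  "schw_deriv_christoffel m x 3 1 3 = 0"
  "schw_deriv_christoffel m x 3 2 3 = 0"
  "schw_deriv_christoffel m x 3 3 3 = 0"
  "schw_deriv_christoffel m x 3 4 3 = vector [0, 0, 0, - 1 / (sin (x $ 3))\<^sup>2]"
  "schw_deriv_christoffel m x 3 1 4 = vector [0, 0, 0, - 2 * x $ 2 * sin (x $ 3) * cos (x $ 3)]"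
  "schw_deriv_christoffel m x 3 2 4
     = vector [0, 0, 0, 2 * (2 * m - x $ 2) * sin (x $ 3) * cos (x $ 3)]"
  "schw_deriv_christoffel m x 3 3 4 = vector [0, 0, 0, (sin (x $ 3))\<^sup>2 - (cos (x $ 3))\<^sup>2]"
  "schw_deriv_christoffel m x 3 4 4 = vector [0, 0, - 1 / (sin (x $ 3))\<^sup>2, 0]"
  "schw_deriv_christoffel m x 4 a b = 0"
  by (simp_all add: schw_deriv_christoffel_def)
    (induct a rule: index_4_induct; simp)+

lemma has_deriv_schw_christoffel:
  assumes "x \<in> schw_domain"
  shows "((\<lambda>h. schw_christoffel m (x + h *\<^sub>R axis k 1) a b $ c) has_real_derivative
           schw_deriv_christoffel m x k a b $ c) (at 0)"
proof -
  \<comment> \<open>The Pythagorean identity in the form left by the derivative of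
    \<open>cos \<theta> / sin \<theta>\<close> once denominators are cleared.\<close>
  have "cos \<theta> * (cos \<theta> * (sin \<theta> * sin \<theta>)) + sin \<theta> * (sin \<theta> * (sin \<theta> * sin \<theta>)) = sin \<theta> * sin \<theta>"
    for \<theta> :: real
    using sin_cos_squared_add3[of \<theta>] by algebra
  then show ?thesis
    using schw_domainD[OF assms]
    by (induct a rule: index_4_induct; induct b rule: index_4_induct;
        induct c rule: index_4_induct; induct k rule: index_4_induct;
        simp add: axis_def)
      (auto simp: field_simps power2_eq_square power3_eq_cube power4_eq_xxxx
        intro!: derivative_eq_intros)
qed

lemma partial_christoffel_schw:
  assumes "x \<in> schw_domain"
  shows "partial k (\<lambda>y. christoffel (schw_metric m) y a b c) x
           = schw_deriv_christoffel m x k a b $ c"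
proof -
  have "partial k (\<lambda>y. christoffel (schw_metric m) y a b c) x
      = partial k (\<lambda>y. schw_christoffel m y a b $ c) x"
    by (rule partial_cong_open[OF open_schw_domain assms]) (rule christoffel_schw)
  also have "\<dots> = schw_deriv_christoffel m x k a b $ c"
    by (rule partialI[OF has_deriv_schw_christoffel[OF assms]])
  finally show ?thesis .
qed

section \<open>Riemann, Ricci and scalar curvature\<close>

definition schw_riemann :: "real \<Rightarrow> real ^ 4 \<Rightarrow> 4 \<Rightarrow> 4 \<Rightarrow> 4 \<Rightarrow> 4 \<Rightarrow> real" where
  "schw_riemann m x e f s t = m / (x $ 2) ^ 3 *
     (kulkarni_nomizu (schw_orbit m x) (schw_sphere x) e f s t
      - kulkarni_nomizu (schw_orbit m x) (schw_orbit m x) e f s t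
      - kulkarni_nomizu (schw_sphere x) (schw_sphere x) e f s t)"

lemma riemann_schw:
  assumes "x \<in> schw_domain"
  shows "riemann (schw_metric m) x e f s t = schw_riemann m x e f s t"
  using schw_domainD[OF assms]
  unfolding riemann_def sum_4 partial_christoffel_schw[OF assms] christoffel_schw[OF assms]
    schw_metric_split schw_riemann_def kulkarni_nomizu_def
  by (induct e rule: index_4_induct; induct f rule: index_4_induct;
      induct s rule: index_4_induct; induct t rule: index_4_induct;
      simp)
    (simp_all add: field_simps power2_eq_square power3_eq_cube power4_eq_xxxx,
      \<comment> \<open>The components still open are polynomial identities modulo
        \<open>sin\<^sup>2 + cos\<^sup>2 = 1\<close>.\<close>
      (use sin_cos_squared_add3[of "x $ 3"] in algebra)+)

text \<open>Both blocks have trace 2 and are orthogonal to each other. Contraction thus turns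
  \<open>h \<and> k\<close> into \<open>2h + 2k\<close>, \<open>h \<and> h\<close> into
  \<open>2h\<close> and \<open>k \<and> k\<close> into \<open>2k\<close>, and these cancel in the
  block formula.\<close>

lemma ricci_schw:
  assumes "x \<in> schw_domain"
  shows "ricci (schw_metric m) x f s = 0"
  using schw_domainD[OF assms]
  unfolding ricci_def sum_4 inv_metric_schw[OF assms] riemann_schw[OF assms]
    schw_riemann_def kulkarni_nomizu_def
  by (induct f rule: index_4_induct; induct s rule: index_4_induct; simp)
    (simp_all add: field_simps eval_nat_numeral)

lemma scalar_curv_schw: "x \<in> schw_domain \<Longrightarrow> scalar_curv (schw_metric m) x = 0"
  by (simp add: scalar_curv_def ricci_schw)

section \<open>Pseudosymmetry\<close>

text \<open>\<open>R\<^sub>c\<^sub>b\<^sub>r\<^sub>s\<close> with \<open>c\<close> projected to the block of \<open>h\<close>, respectively \<open>k\<close>.\<close>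

definition schw_orbit_riemann :: "real \<Rightarrow> real ^ 4 \<Rightarrow> 4 \<Rightarrow> 4 \<Rightarrow> 4 \<Rightarrow> 4 \<Rightarrow> real" where
  "schw_orbit_riemann m x c b r s = m / (x $ 2) ^ 3 *
     (schw_orbit m x c s * schw_sphere x b r - schw_orbit m x c r * schw_sphere x b s
      - 2 * (schw_orbit m x c s * schw_orbit m x b r - schw_orbit m x c r * schw_orbit m x b s))"

definition schw_sphere_riemann :: "real \<Rightarrow> real ^ 4 \<Rightarrow> 4 \<Rightarrow> 4 \<Rightarrow> 4 \<Rightarrow> 4 \<Rightarrow> real" where
  "schw_sphere_riemann m x c b r s = m / (x $ 2) ^ 3 *
     (schw_sphere x c s * schw_orbit m x b r - schw_sphere x c r * schw_orbit m x b s
      - 2 * (schw_sphere x c s * schw_sphere x b r - schw_sphere x c r * schw_sphere x b s))"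

text \<open>Raising an index and contracting it with one block is the projection to that block. The
  factor 2 in the results comes from \<open>h \<and> h\<close> and \<open>k \<and> k\<close>, in
  which each product occurs twice.\<close>

lemma riemann_up_contract:
  assumes "x \<in> schw_domain"
  shows riemann_up_contract_orbit:
      "(\<Sum>a\<in>UNIV. riemann_up (schw_metric m) x a b r s * schw_orbit m x a c)
         = schw_orbit_riemann m x c b r s"
    and riemann_up_contract_sphere:
      "(\<Sum>a\<in>UNIV. riemann_up (schw_metric m) x a b r s * schw_sphere x a c)
         = schw_sphere_riemann m x c b r s"
  using schw_domainD[OF assms]
  unfolding riemann_up_def sum_4 inv_metric_schw[OF assms] riemann_schw[OF assms]
    schw_riemann_def kulkarni_nomizu_def schw_orbit_riemann_def schw_sphere_riemann_def
  by (induct c rule: index_4_induct; simp; simp add: field_simps)+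

lemma sum_lessThan_4: "(\<Sum>i<4. f i) = f 0 + f 1 + f 2 + (f (3::nat) :: real)"
  by (simp add: eval_nat_numeral)

lemma curv_dot_schw:
  assumes "x \<in> schw_domain" "length bs = 4"
  shows "curv_dot (schw_metric m) (riemann_list (schw_metric m)) x bs r s
           = m / (x $ 2) ^ 3 * tachibana (schw_metric m) (riemann_list (schw_metric m)) x bs r s"
proof -
  obtain e f t u where bs: "bs = [e, f, t, u]"
    using assms(2) by (auto simp: length_Suc_conv eval_nat_numeral)
  let ?R = "riemann_up (schw_metric m) x"
  let ?h = "schw_orbit m x" and ?k = "schw_sphere x"
  define K where "K = m / (x $ 2) ^ 3"
  note contract = riemann_up_contract[OF assms(1), of m]
  \<comment> \<open>In each product of the block formula the index \<open>a\<close> sits in a single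
    factor \<open>h\<close> or \<open>k\<close>, so the sum reduces to the two contractions.\<close>
  have 1: "(\<Sum>a\<in>UNIV. ?R a b r s * schw_riemann m x a f t u) = K *
      (schw_orbit_riemann m x u b r s * ?k f t + ?h f t * schw_sphere_riemann m x u b r s
       - schw_orbit_riemann m x t b r s * ?k f u - ?h f u * schw_sphere_riemann m x t b r s
       - 2 * (schw_orbit_riemann m x u b r s * ?h f t - schw_orbit_riemann m x t b r s * ?h f u)
       - 2 * (schw_sphere_riemann m x u b r s * ?k f t - schw_sphere_riemann m x t b r s * ?k f u))"
    for b f t u
    unfolding contract[symmetric] schw_riemann_def kulkarni_nomizu_def K_def
    by (simp add: sum_4 algebra_simps)
  \<comment> \<open>The symmetries of the curvature move the contracted index to the first slot, so
    that \<open>1\<close> covers all four terms of \<open>R \<cdot> R\<close>.\<close>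
  have swap: "schw_riemann m x e a t u = - schw_riemann m x a e t u"
    "schw_riemann m x e f a u = schw_riemann m x a u e f"
    "schw_riemann m x e f t a = - schw_riemann m x a t e f" for a
    unfolding schw_riemann_def kulkarni_nomizu_def
    by (simp_all add: schw_orbit_commute schw_sphere_commute algebra_simps)
  have expand: "curv_dot (schw_metric m) (riemann_list (schw_metric m)) x bs r s
      = - (\<Sum>a\<in>UNIV. ?R a e r s * schw_riemann m x a f t u)
        + (\<Sum>a\<in>UNIV. ?R a f r s * schw_riemann m x a e t u)
        - (\<Sum>a\<in>UNIV. ?R a t r s * schw_riemann m x a u e f)
        + (\<Sum>a\<in>UNIV. ?R a u r s * schw_riemann m x a t e f)"
    by (simp add: curv_dot_def bs sum_lessThan_4 riemann_list_def riemann_schw[OF assms(1)]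
        swap sum_negf)
  show ?thesis
    \<comment> \<open>With \<open>K\<close> kept opaque, a polynomial identity in the entries of the
      two symmetric blocks remains.\<close>
    unfolding expand 1 schw_orbit_riemann_def schw_sphere_riemann_def K_def[symmetric]
    by (simp add: tachibana_def bs sum_lessThan_4 riemann_list_def riemann_schw[OF assms(1)]
        schw_metric_split schw_riemann_def kulkarni_nomizu_def K_def[symmetric]
        algebra_simps schw_orbit_commute schw_sphere_commute)
qed

section \<open>Covariant derivative and divergence of the curvature\<close>

lemma has_deriv_kulkarni_nomizu:
  assumes "\<And>i j. ((\<lambda>h. X h i j) has_real_derivative X' i j) (at a)"
    and "\<And>i j. ((\<lambda>h. Z h i j) has_real_derivative Z' i j) (at a)"
  shows "((\<lambda>h. kulkarni_nomizu (X h) (Z h) e f s t) has_real_derivative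
           kulkarni_nomizu X' (Z a) e f s t + kulkarni_nomizu (X a) Z' e f s t) (at a)"
  unfolding kulkarni_nomizu_def
  by (rule derivative_eq_intros assms refl)+ (simp add: algebra_simps)

lemma kulkarni_nomizu_add:
  "kulkarni_nomizu (\<lambda>i j. X i j + X' i j) Z e f s t
     = kulkarni_nomizu X Z e f s t + kulkarni_nomizu X' Z e f s t"
  "kulkarni_nomizu Z (\<lambda>i j. X i j + X' i j) e f s t
     = kulkarni_nomizu Z X e f s t + kulkarni_nomizu Z X' e f s t"
  by (simp_all add: kulkarni_nomizu_def algebra_simps)

lemma kulkarni_nomizu_diff:
  "kulkarni_nomizu (\<lambda>i j. X i j - X' i j) Z e f s t
     = kulkarni_nomizu X Z e f s t - kulkarni_nomizu X' Z e f s t"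
  "kulkarni_nomizu Z (\<lambda>i j. X i j - X' i j) e f s t
     = kulkarni_nomizu Z X e f s t - kulkarni_nomizu Z X' e f s t"
  by (simp_all add: kulkarni_nomizu_def algebra_simps)

text \<open>The Christoffel terms of a covariant derivative form a derivation; \<open>G a i\<close> stands for
  \<open>\<Gamma>\<^sup>a\<^sub>k\<^sub>i\<close> with \<open>k\<close> fixed.\<close>

definition connection_action ::
  "('n::finite \<Rightarrow> 'n \<Rightarrow> real) \<Rightarrow> ('n \<Rightarrow> 'n \<Rightarrow> real) \<Rightarrow> 'n \<Rightarrow> 'n \<Rightarrow> real" where
  "connection_action G X i j = (\<Sum>a\<in>UNIV. G a i * X a j + G a j * X i a)"

definition connection_action4 ::
  "('n::finite \<Rightarrow> 'n \<Rightarrow> real) \<Rightarrow> ('n \<Rightarrow> 'n \<Rightarrow> 'n \<Rightarrow> 'n \<Rightarrow> real) \<Rightarrow>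
     'n \<Rightarrow> 'n \<Rightarrow> 'n \<Rightarrow> 'n \<Rightarrow> real" where
  "connection_action4 G W e f s t = (\<Sum>a\<in>UNIV.
     G a e * W a f s t + G a f * W e a s t + G a s * W e f a t + G a t * W e f s a)"

text \<open>The Leibniz rule: in each product every index belongs to exactly one of the two
  factors.\<close>

lemma connection_action4_kulkarni_nomizu:
  "connection_action4 G (kulkarni_nomizu X Z) e f s t
     = kulkarni_nomizu (connection_action G X) Z e f s t
       + kulkarni_nomizu X (connection_action G Z) e f s t"
  by (simp add: connection_action4_def connection_action_def kulkarni_nomizu_def
      sum_distrib_left sum_distrib_right algebra_simps flip: sum.distrib sum_subtractf)

lemma cov_deriv_riemann:
  "cov_deriv g (riemann_list g) x k [e, f, s, t] =
     partial k (\<lambda>y. riemann g y e f s t) x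
     - connection_action4 (\<lambda>a. christoffel g x a k) (riemann g x) e f s t"
  by (simp add: cov_deriv_def riemann_list_def connection_action4_def eval_nat_numeral sum.distrib)

text \<open>\<open>\<nabla>\<^sub>k h\<^sub>i\<^sub>j\<close>, which is also \<open>- \<nabla>\<^sub>k k\<^sub>i\<^sub>j\<close>.\<close>

definition schw_cov_deriv_orbit :: "real ^ 4 \<Rightarrow> 4 \<Rightarrow> 4 \<Rightarrow> 4 \<Rightarrow> real" where
  "schw_cov_deriv_orbit x k i j =
     ((if j = 2 then schw_sphere x k i else 0) + (if i = 2 then schw_sphere x k j else 0)) / x $ 2"

text \<open>An equation between functions of \<open>i j\<close>, so that it rewrites inside
  \<open>kulkarni_nomizu\<close>; the connection part then cancels against the Christoffel terms of
  the covariant derivative.\<close>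

lemma schw_deriv_orbit_eq:
  assumes "x \<in> schw_domain"
  shows "schw_deriv_orbit m x k = (\<lambda>i j.
    connection_action (\<lambda>a. ($) (schw_christoffel m x a k)) (schw_orbit m x) i j
      + schw_cov_deriv_orbit x k i j)"
proof (intro ext)
  fix i j
  show "schw_deriv_orbit m x k i j =
    connection_action (\<lambda>a. ($) (schw_christoffel m x a k)) (schw_orbit m x) i j
      + schw_cov_deriv_orbit x k i j"
    using schw_domainD[OF assms]
    unfolding connection_action_def schw_cov_deriv_orbit_def schw_deriv_orbit_def sum_4
    by (induct k rule: index_4_induct; induct i rule: index_4_induct;
        induct j rule: index_4_induct; simp)
      (simp_all add: field_simps eval_nat_numeral)
qed

lemma schw_deriv_sphere_eq:
  assumes "x \<in> schw_domain"
  shows "schw_deriv_sphere x k = (\<lambda>i j.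
    connection_action (\<lambda>a. ($) (schw_christoffel m x a k)) (schw_sphere x) i j
      - schw_cov_deriv_orbit x k i j)"
proof (intro ext)
  fix i j
  show "schw_deriv_sphere x k i j =
    connection_action (\<lambda>a. ($) (schw_christoffel m x a k)) (schw_sphere x) i j
      - schw_cov_deriv_orbit x k i j"
    using schw_domainD[OF assms]
    unfolding connection_action_def schw_cov_deriv_orbit_def schw_deriv_sphere_def sum_4
    by (induct k rule: index_4_induct; induct i rule: index_4_induct;
        induct j rule: index_4_induct; simp)
      (simp_all add: field_simps eval_nat_numeral)
qed

text \<open>The product rule for the block formula. The logarithmic derivative
  \<open>- 3 / x $ 2\<close> of \<open>m / (x $ 2) ^ 3\<close> makes the first summand a multiple of
  the curvature.\<close>

definition schw_deriv_riemann ::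
  "real \<Rightarrow> real ^ 4 \<Rightarrow> 4 \<Rightarrow> 4 \<Rightarrow> 4 \<Rightarrow> 4 \<Rightarrow> 4 \<Rightarrow> real" where
  "schw_deriv_riemann m x k e f s t =
     (if k = 2 then - 3 / x $ 2 else 0) * schw_riemann m x e f s t
     + m / (x $ 2) ^ 3 *
       (kulkarni_nomizu (schw_deriv_orbit m x k) (schw_sphere x) e f s t
        + kulkarni_nomizu (schw_orbit m x) (schw_deriv_sphere x k) e f s t
        - (kulkarni_nomizu (schw_deriv_orbit m x k) (schw_orbit m x) e f s t
           + kulkarni_nomizu (schw_orbit m x) (schw_deriv_orbit m x k) e f s t)
        - (kulkarni_nomizu (schw_deriv_sphere x k) (schw_sphere x) e f s t
           + kulkarni_nomizu (schw_sphere x) (schw_deriv_sphere x k) e f s t))"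

lemma partial_riemann_schw:
  assumes "x \<in> schw_domain"
  shows "partial k (\<lambda>y. riemann (schw_metric m) y e f s t) x = schw_deriv_riemann m x k e f s t"
proof -
  have K: "((\<lambda>h. m / ((x + h *\<^sub>R axis k 1) $ 2) ^ 3) has_real_derivative
      (if k = 2 then - 3 / x $ 2 else 0) * (m / (x $ 2) ^ 3)) (at 0)"
    using schw_domainD[OF assms]
    by (auto simp: axis_def field_simps eval_nat_numeral intro!: derivative_eq_intros)
  have "((\<lambda>h. schw_riemann m (x + h *\<^sub>R axis k 1) e f s t) has_real_derivative
      schw_deriv_riemann m x k e f s t) (at 0)"
    unfolding schw_riemann_def
    by (rule DERIV_cong[OF DERIV_mult[OF K DERIV_diff[OF DERIV_diff]]],
        (rule has_deriv_kulkarni_nomizu has_deriv_schw_orbit has_deriv_schw_sphere assms)+)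
      (simp add: schw_deriv_riemann_def schw_riemann_def mult_ac)
  then have "partial k (\<lambda>y. schw_riemann m y e f s t) x = schw_deriv_riemann m x k e f s t"
    by (rule partialI)
  then show ?thesis
    using partial_cong_open[OF open_schw_domain assms riemann_schw] by simp
qed

text \<open>With \<open>A = \<nabla>h = - \<nabla>k\<close>, the three products contribute
  \<open>A \<and> k - h \<and> A\<close>, \<open>- 2 A \<and> h\<close> and
  \<open>2 A \<and> k\<close>, together \<open>3 A \<and> (k - h)\<close>.\<close>

lemma cov_deriv_riemann_schw:
  assumes "x \<in> schw_domain"
  shows "cov_deriv (schw_metric m) (riemann_list (schw_metric m)) x k [e, f, s, t]
    = (if k = 2 then - 3 / x $ 2 else 0) * schw_riemann m x e f s t
      + 3 * m / (x $ 2) ^ 3 *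
        kulkarni_nomizu (schw_cov_deriv_orbit x k)
          (\<lambda>i j. schw_sphere x i j - schw_orbit m x i j) e f s t"
proof -
  let ?G = "\<lambda>a. ($) (schw_christoffel m x a k)"
  have kn_commute: "kulkarni_nomizu X Z = kulkarni_nomizu Z X" for X Z :: "4 \<Rightarrow> 4 \<Rightarrow> real"
    by (intro ext) (simp add: kulkarni_nomizu_def)
  have "connection_action4 ?G (schw_riemann m x) e f s t
      = m / (x $ 2) ^ 3 *
        (connection_action4 ?G (kulkarni_nomizu (schw_orbit m x) (schw_sphere x)) e f s t
         - connection_action4 ?G (kulkarni_nomizu (schw_orbit m x) (schw_orbit m x)) e f s t
         - connection_action4 ?G (kulkarni_nomizu (schw_sphere x) (schw_sphere x)) e f s t)"
    by (simp add: connection_action4_def schw_riemann_def sum_distrib_left right_diff_distrib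
        distrib_left sum.distrib sum_subtractf mult.left_commute)
  then show ?thesis
    unfolding cov_deriv_riemann partial_riemann_schw[OF assms] schw_deriv_riemann_def
      schw_deriv_orbit_eq[OF assms] schw_deriv_sphere_eq[OF assms, of _ m]
      christoffel_schw[OF assms] riemann_schw[OF assms] connection_action4_kulkarni_nomizu
      kulkarni_nomizu_add kulkarni_nomizu_diff
    by (simp add: algebra_simps kn_commute[of "schw_cov_deriv_orbit x k"])
qed

text \<open>The inverse metric has five nonzero entries. For a generic \<open>X\<close>, the sum of
  sixteen terms collapses before any curvature component is unfolded.\<close>

lemma inv_metric_contract_schw:
  assumes "x \<in> schw_domain"
  shows "(\<Sum>e\<in>UNIV. \<Sum>k\<in>UNIV. inv_metric (schw_metric m) x e k * X e k)
    = - X 1 2 - X 2 1 - (1 - 2 * m / x $ 2) * X 2 2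
      - X 3 3 / (x $ 2)\<^sup>2 - X 4 4 / ((x $ 2)\<^sup>2 * (sin (x $ 3))\<^sup>2)"
  by (simp add: sum_4 inv_metric_schw[OF assms] left_diff_distrib)

text \<open>Upon contraction, the term from the radial decay of \<open>m / (x $ 2) ^ 3\<close>
  cancels the term from \<open>\<nabla>h\<close>.\<close>

lemma div_riemann_schw:
  assumes "x \<in> schw_domain"
  shows "div_riemann (schw_metric m) x f s t = 0"
  using schw_domainD[OF assms]
  unfolding div_riemann_def inv_metric_contract_schw[OF assms] cov_deriv_riemann_schw[OF assms]
    schw_riemann_def kulkarni_nomizu_def schw_cov_deriv_orbit_def
  by (induct f rule: index_4_induct; induct s rule: index_4_induct;
      induct t rule: index_4_induct; simp)
    (simp_all add: field_simps eval_nat_numeral)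

section \<open>Compatible tensors\<close>

definition orbit_part :: "real ^ 4 ^ 4 \<Rightarrow> 4 \<Rightarrow> 4 \<Rightarrow> real" where
  "orbit_part M e f = (if f = 1 \<or> f = 2 then M $ e $ f else 0)"

definition sphere_part :: "real ^ 4 ^ 4 \<Rightarrow> 4 \<Rightarrow> 4 \<Rightarrow> real" where
  "sphere_part M e f = (if f = 3 \<or> f = 4 then M $ e $ f else 0)"

text \<open>Only the second index of \<open>H\<close> is raised and contracted, so only that index
  is projected to a block; the first one stays free.\<close>

lemma raise2_contract:
  assumes "x \<in> schw_domain"
  shows raise2_contract_orbit:
      "(\<Sum>d\<in>UNIV. raise2 (schw_metric m) H x e d * schw_orbit m x f d) = orbit_part (H x) e f"
    and raise2_contract_sphere:
      "(\<Sum>d\<in>UNIV. raise2 (schw_metric m) H x e d * schw_sphere x f d) = sphere_part (H x) e f"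
  using schw_domainD[OF assms]
  unfolding raise2_def sum_4 inv_metric_schw[OF assms] orbit_part_def sphere_part_def
  by (induct f rule: index_4_induct; simp add: field_simps)+

lemma raise2_contract_riemann:
  assumes "x \<in> schw_domain"
  shows "(\<Sum>d\<in>UNIV. raise2 (schw_metric m) H x e d * riemann (schw_metric m) x f s t d)
    = m / (x $ 2) ^ 3 *
      (schw_orbit m x s t * (sphere_part (H x) e f - 2 * orbit_part (H x) e f)
       + schw_sphere x s t * (orbit_part (H x) e f - 2 * sphere_part (H x) e f)
       - schw_orbit m x f t * (sphere_part (H x) e s - 2 * orbit_part (H x) e s)
       - schw_sphere x f t * (orbit_part (H x) e s - 2 * sphere_part (H x) e s))"
  unfolding raise2_contract[OF assms, of m, symmetric] riemann_schw[OF assms]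
    schw_riemann_def kulkarni_nomizu_def
  by (simp add: sum_4 algebra_simps)

text \<open>The coefficient of an entry of \<open>h\<close> in the cyclic sum: the entry arises from
  two of the three terms, with opposite signs and \<open>e\<close>, \<open>f\<close> exchanged.
  \<open>sphere_defect\<close> is the same for \<open>k\<close>.\<close>

definition orbit_defect :: "real ^ 4 ^ 4 \<Rightarrow> 4 \<Rightarrow> 4 \<Rightarrow> real" where
  "orbit_defect M e f = sphere_part M e f - 2 * orbit_part M e f
     - (sphere_part M f e - 2 * orbit_part M f e)"

definition sphere_defect :: "real ^ 4 ^ 4 \<Rightarrow> 4 \<Rightarrow> 4 \<Rightarrow> real" where
  "sphere_defect M e f = orbit_part M e f - 2 * sphere_part M e f
     - (orbit_part M f e - 2 * sphere_part M f e)"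

lemma cyclic_sum_schw:
  assumes "x \<in> schw_domain"
  shows "(\<Sum>d\<in>UNIV. raise2 (schw_metric m) H x e d * riemann (schw_metric m) x f s t d)
       + (\<Sum>d\<in>UNIV. raise2 (schw_metric m) H x f d * riemann (schw_metric m) x s e t d)
       + (\<Sum>d\<in>UNIV. raise2 (schw_metric m) H x s d * riemann (schw_metric m) x e f t d)
    = m / (x $ 2) ^ 3 *
      (schw_orbit m x s t * orbit_defect (H x) e f + schw_sphere x s t * sphere_defect (H x) e f
       + schw_orbit m x e t * orbit_defect (H x) f s + schw_sphere x e t * sphere_defect (H x) f s
       + schw_orbit m x f t * orbit_defect (H x) s e + schw_sphere x f t * sphere_defect (H x) s e)"
  unfolding raise2_contract_riemann[OF assms] orbit_defect_def sphere_defect_def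
  by (simp add: algebra_simps)

definition block_diagonal_symmetric :: "real ^ 4 ^ 4 \<Rightarrow> bool" where
  "block_diagonal_symmetric M \<longleftrightarrow> M $ 2 $ 1 = M $ 1 $ 2 \<and> M $ 4 $ 3 = M $ 3 $ 4 \<and>
     (\<forall>i\<in>{1, 2}. \<forall>j\<in>{3, 4}. M $ i $ j = 0 \<and> M $ j $ i = 0)"

lemma block_diagonal_symmetric_eq:
  "block_diagonal_symmetric M \<longleftrightarrow> M = vector
     [vector [M $ 1 $ 1, M $ 1 $ 2, 0, 0],
      vector [M $ 1 $ 2, M $ 2 $ 2, 0, 0],
      vector [0, 0, M $ 3 $ 3, M $ 3 $ 4],
      vector [0, 0, M $ 3 $ 4, M $ 4 $ 4]]"
  by (auto simp: vec_eq_iff forall_4 block_diagonal_symmetric_def)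

lemma compatible_schw_if:
  assumes "\<And>x. x \<in> schw_domain \<Longrightarrow> block_diagonal_symmetric (H x)"
  shows "compatible_on schw_domain (schw_metric m) H"
proof -
  have "orbit_defect (H x) e f = 0" "sphere_defect (H x) e f = 0" if "x \<in> schw_domain" for x e f
    using assms[OF that]
    unfolding orbit_defect_def sphere_defect_def block_diagonal_symmetric_def
      orbit_part_def sphere_part_def
    by (induct e rule: index_4_induct; induct f rule: index_4_induct; simp)+
  then show ?thesis
    by (simp add: compatible_on_def cyclic_sum_schw)
qed

text \<open>For \<open>m = 0\<close> the curvature vanishes and every tensor is compatible.
  Otherwise the factor \<open>m / (x $ 2) ^ 3\<close> cancels, and suitable indices in the cyclic
  sum isolate single defects.\<close>

lemma compatible_schw_only_if:
  assumes "m \<noteq> 0" "compatible_on schw_domain (schw_metric m) H" "x \<in> schw_domain"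
  shows "block_diagonal_symmetric (H x)"
proof -
  have cyc: "schw_orbit m x s t * orbit_defect (H x) e f
       + schw_sphere x s t * sphere_defect (H x) e f
       + schw_orbit m x e t * orbit_defect (H x) f s + schw_sphere x e t * sphere_defect (H x) f s
       + schw_orbit m x f t * orbit_defect (H x) s e + schw_sphere x f t * sphere_defect (H x) s e
       = 0" for e f s t
    using assms(2)[unfolded compatible_on_def, rule_format, OF assms(3), of e f s t]
      schw_domainD[OF assms(3)] assms(1)
    by (simp add: cyclic_sum_schw[OF assms(3)])
  note pos = schw_domainD[OF assms(3)]
  have defect_commute: "orbit_defect (H x) j i = - orbit_defect (H x) i j" for i j
    by (simp add: orbit_defect_def)
  \<comment> \<open>The variables of \<open>cyc\<close> are instantiated in their order of
    occurrence \<open>s t e f\<close>. With \<open>s\<close>, \<open>t\<close> in one block and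
    \<open>e\<close>, \<open>f\<close> in the other, a single product survives.\<close>
  have sym: "H x $ 2 $ 1 = H x $ 1 $ 2" "H x $ 4 $ 3 = H x $ 3 $ 4"
    using cyc[of 3 3 1 2] cyc[of 1 2 3 4] pos
    by (simp_all add: orbit_defect_def sphere_defect_def orbit_part_def sphere_part_def)
  \<comment> \<open>As \<open>h\<close> vanishes at \<open>2 2\<close>, the first instance settles
    \<open>i = 2\<close>. The second contains both defects, because the entry of \<open>h\<close> at
    \<open>1 1\<close> may be nonzero, and then settles \<open>i = 1\<close>.\<close>
  have orbit: "orbit_defect (H x) i j = 0" if "i \<in> {1, 2}" "j \<in> {3, 4}" for i j
    using that cyc[of 1 2 2 j] cyc[of 2 1 1 j] by (auto simp: defect_commute[of _ j])
  \<comment> \<open>The sphere block is diagonal, so each instance isolates one defect.\<close>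
  have sphere: "sphere_defect (H x) i j = 0" if "i \<in> {1, 2}" "j \<in> {3, 4}" for i j
    using that cyc[of 3 3 i 4] cyc[of 4 4 i 3] pos by auto
  \<comment> \<open>Writing \<open>a\<close> and \<open>b\<close> for the entries at
    \<open>i j\<close> and \<open>j i\<close>, the defects are \<open>a + 2b\<close> and
    \<open>- 2a - b\<close>: a nonsingular system.\<close>
  have "H x $ i $ j = 0 \<and> H x $ j $ i = 0" if "i \<in> {1, 2}" "j \<in> {3, 4}" for i j
    using that orbit[OF that] sphere[OF that]
    by (auto simp: orbit_defect_def sphere_defect_def orbit_part_def sphere_part_def)
  with sym show ?thesis
    by (simp add: block_diagonal_symmetric_def)
qed

section \<open>The curvature properties combined\<close>

lemma schw_deszcz_pseudosymmetric: "deszcz_pseudosymmetric_on schw_domain (schw_metric m)"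
  unfolding deszcz_pseudosymmetric_on_def Let_def smooth_on_def
  \<comment> \<open>This factor is smooth wherever \<open>x $ 2 > 0\<close>, hence on the subset
    where the Tachibana tensor is nonzero.\<close>
  by (rule exI[of _ "\<lambda>x. m / (x $ 2) ^ 3"])
    (auto simp: curv_dot_schw schw_domain_def intro!: C_on_subset[OF C_on_inverse_power])

theorem corollary3p3:
  fixes m :: real
  defines "g \<equiv> schw_metric m"
  shows
    "(ricci_flat_on schw_domain g \<and>
      (\<forall>x\<in>schw_domain.
         riemann g x = concircular g x \<and>
         riemann g x = conformal_weyl g x \<and>
         riemann g x = conharmonic g x \<and>
         riemann g x = projective g x)) \<and>
     ((\<forall>x\<in>schw_domain. \<forall>bs r s. length bs = 4 \<longrightarrow>
         curv_dot g (riemann_list g) x bs r s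
           = m / (x $ 2) ^ 3 * tachibana g (riemann_list g) x bs r s) \<and>
      deszcz_pseudosymmetric_on schw_domain g) \<and>
     ((\<forall>x\<in>schw_domain. \<forall>f s t. div_riemann g x f s t = 0) \<and>
      harmonic_curvature_on schw_domain g) \<and>
     (\<forall>H :: real ^ 4 \<Rightarrow> real ^ 4 ^ 4.
        let general_form = (\<exists>h11 h12 h22 h33 h34 h44 :: real ^ 4 \<Rightarrow> real.
              \<forall>x\<in>schw_domain. H x = vector
                [vector [h11 x, h12 x, 0, 0],
                 vector [h12 x, h22 x, 0, 0],
                 vector [0, 0, h33 x, h34 x],
                 vector [0, 0, h34 x, h44 x]])
        in (general_form \<longrightarrow> compatible_on schw_domain g H) \<and>
           (m \<noteq> 0 \<longrightarrow> compatible_on schw_domain g H \<longrightarrow> general_form))"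
proof -
  have harmonic: "div_riemann g x f s t = 0" if "x \<in> schw_domain" for x f s t
    unfolding g_def by (rule div_riemann_schw[OF that])
  have general_form: "(\<exists>h11 h12 h22 h33 h34 h44 :: real ^ 4 \<Rightarrow> real.
      \<forall>x\<in>schw_domain. H x = vector
        [vector [h11 x, h12 x, 0, 0],
         vector [h12 x, h22 x, 0, 0],
         vector [0, 0, h33 x, h34 x],
         vector [0, 0, h34 x, h44 x]])
    \<longleftrightarrow> (\<forall>x\<in>schw_domain. block_diagonal_symmetric (H x))"
    (is "?form \<longleftrightarrow> ?block") for H :: "real ^ 4 \<Rightarrow> real ^ 4 ^ 4"
  proof
    show ?block if ?form
      using that by (auto simp: block_diagonal_symmetric_def)
    show ?form if ?block
      \<comment> \<open>The entries of \<open>H x\<close> themselves serve as the six scalar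
        functions.\<close>
      using that unfolding block_diagonal_symmetric_eq by fast
  qed
  \<comment> \<open>Every correction term of the four derived curvature tensors contains the Ricci
    tensor or the scalar curvature, and so vanishes.\<close>
  show ?thesis
    unfolding Let_def general_form
    using harmonic compatible_schw_if compatible_schw_only_if schw_deszcz_pseudosymmetric
    by (auto simp: g_def ricci_flat_on_def harmonic_curvature_on_def ricci_schw scalar_curv_schw
        concircular_def conformal_weyl_def conharmonic_def projective_def kulkarni_nomizu_def
        curv_dot_schw fun_eq_iff)
qed

end
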